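(* Let $E,E_0$ be Banach spaces satisfying: (H1) $E,E_0\in\mathcal G$, with scaling exponents $\sigma_E,\sigma_{E_0}$. (H2) The Riesz transforms $\mathcal R_j:E_0'\to E_0'$, $j=1,\dots,n$, are bounded. (H3) For all $f,g\in E'$ the product $fg$ belongs to $E_0'$ and $\|fg\|_{E_0'}\le C\|f\|_{E'}\|g\|_{E'}$, with $C>0$ a universal constant. (H4) $\nabla U(t):E\to E_0$ is a bounded operator and $\displaystyle\int_0^\infty s^{\frac12(\sigma_{E_0}-\sigma_E)-\frac12}\|\nabla U(s)f\|_{E_0}\,ds\le C\|f\|_E$ for all $f\in E$. Assume moreover that $\sigma_{E_0}-\sigma_E-1=0$. Then there is a universal constant $K>0$ such that $$\sup_{0<t<T}\|\mathcal B(u,v)(t)\|_{E'}\le K\sup_{0<t<T}\|u(t)\|_{E'}\,\sup_{0<t<T}\|v(t)\|_{E'}$$ for all $u,v\in L^\infty((0,T);E')$ and all $T\in(0,\infty]$.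
   Context: All spaces are over $\mathbb R^n$, $n\ge3$. For $f\in\mathcal S'$ and $\lambda>0$, $f_\lambda=f(\lambda\,\cdot)$. $\mathcal G$ is the class of all Banach spaces $F\subset\mathcal S'$ for which there exist $\sigma_F\in\mathbb R$ and $C>0$ such that $f_\lambda\in F$ and $\|f_\lambda\|_F\le C\lambda^{\sigma_F}\|f\|_F$ for all $\lambda>0$, $f\in F$. $E'$ denotes the dual of $E$. $\Phi(t,x)=(4\pi t)^{-n/2}e^{-|x|^2/(4t)}$, $U(t)f=\Phi(t,\cdot)*f$, $\nabla U(t)f=(\nabla\Phi(t,\cdot))*f$. The Riesz transform is $\mathcal R_jf(x)=c_n\,\mathrm{P.V.}\!\int\frac{y_j}{|y|^{n+1}}f(x-y)\,dy$, $c_n=\Gamma(\frac{n+1}2)\pi^{-(n+1)/2}$, and the Leray projector is the matrix operator $\mathbb P=(\delta_{kj}+\mathcal R_k\mathcal R_j)_{k,j}$. The bilinear form, for vector fields $u,v$ (all norms taken componentwise), is $$\mathcal B(u,v)(t)=-\int_0^t\nabla U(t-s)\cdot\mathbb P(u\otimes v)(s)\,ds,$$ where the integral is understood weakly, i.e. as the element of $E'$ given by $\langle\mathcal B(u,v)(t),h\rangle=-\int_0^t\langle\nabla U(t-s)\cdot\mathbb P(u\otimes v)(s),h\rangle ds$, $h\in E$, and $\nabla U(s):E_0'\to E'$ is defined by duality, $\langle\nabla U(s)g,h\rangle=-\langle g,\nabla U(s)h\rangle$. *)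

theory Defs
  imports "HOL-Analysis.Analysis" "HOL-Probability.Essential_Supremum"
begin

fun partials :: "'n list \<Rightarrow> (real ^ 'n \<Rightarrow> real) \<Rightarrow> real ^ 'n \<Rightarrow> real" where
  "partials [] f = f"
| "partials (i # is) f = (\<lambda>x. frechet_derivative (partials is f) (at x) (axis i 1))"

definition schwartz :: "(real ^ 'n \<Rightarrow> real) set" where
  "schwartz = {f. \<forall>is. partials is f differentiable_on UNIV \<and>
      (\<forall>m::nat. \<exists>C. \<forall>x. (1 + norm x) ^ m * \<bar>partials is f x\<bar> \<le> C)}"

definition schwartz_norm :: "nat \<Rightarrow> (real ^ 'n \<Rightarrow> real) \<Rightarrow> real" where
  "schwartz_norm m f =
     (\<Sum>is\<in>{is. length is \<le> m}. SUP x. (1 + norm x) ^ m * \<bar>partials is f x\<bar>)"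

text \<open>A distribution is a functional on all functions \<open>real ^ 'n \<Rightarrow> real\<close> of which only the values on
  \<^const>\<open>schwartz\<close> matter; accordingly equations between distributions are always stated on
  \<^const>\<open>schwartz\<close>.\<close>

type_synonym 'n dist = "(real ^ 'n \<Rightarrow> real) \<Rightarrow> real"

definition tempered :: "'n::finite dist \<Rightarrow> bool" where
  "tempered S \<longleftrightarrow>
     (\<forall>\<phi>\<in>schwartz. \<forall>\<psi>\<in>schwartz. S (\<lambda>x. \<phi> x + \<psi> x) = S \<phi> + S \<psi>) \<and>
     (\<forall>c. \<forall>\<phi>\<in>schwartz. S (\<lambda>x. c * \<phi> x) = c * S \<phi>) \<and>
     (\<exists>m C. \<forall>\<phi>\<in>schwartz. \<bar>S \<phi>\<bar> \<le> C * schwartz_norm m \<phi>)"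

definition dist_eq :: "'n::finite dist \<Rightarrow> 'n dist \<Rightarrow> bool" where
  "dist_eq S S' \<longleftrightarrow> (\<forall>\<phi>\<in>schwartz. S \<phi> = S' \<phi>)"

definition regular_dist :: "(real ^ 'n \<Rightarrow> real) \<Rightarrow> 'n::finite dist" where
  "regular_dist a = (\<lambda>\<phi>. LINT x|lebesgue. a x * \<phi> x)"

text \<open>\<open>f(l \<cdot>)\<close>, by duality: the substitution \<open>x \<mapsto> x / l\<close> has Jacobian \<open>l\<^sup>-\<^sup>n\<close>.\<close>

definition dilate :: "real \<Rightarrow> 'n::finite dist \<Rightarrow> 'n dist" where
  "dilate l S = (\<lambda>\<phi>. S (\<lambda>x. \<phi> (x /\<^sub>R l)) / l ^ CARD('n))"

text \<open>\<open>\<langle>g * S, \<phi>\<rangle> = \<langle>S, g(- \<cdot>) * \<phi>\<rangle>\<close>.\<close>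

definition conv_dist :: "(real ^ 'n \<Rightarrow> real) \<Rightarrow> 'n::finite dist \<Rightarrow> 'n dist" where
  "conv_dist g S = (\<lambda>\<phi>. S (\<lambda>y. LINT x|lebesgue. g (x - y) * \<phi> x))"

text \<open>A Banach space \<open>F\<close> contained in the tempered distributions is a type \<open>'e :: banach\<close> together with a
  linear injection \<open>\<iota>\<close>; continuity of \<open>\<iota>\<close> is not required. Its dual is \<open>'e \<Rightarrow>\<^sub>L real\<close>.\<close>

definition dist_space :: "('e::banach \<Rightarrow> 'n::finite dist) \<Rightarrow> bool" where
  "dist_space \<iota> \<longleftrightarrow>
     (\<forall>f. tempered (\<iota> f)) \<and>
     (\<forall>\<phi>\<in>schwartz. linear (\<lambda>f. \<iota> f \<phi>)) \<and>
     (\<forall>f g. dist_eq (\<iota> f) (\<iota> g) \<longrightarrow> f = g)"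

definition class_G :: "('e::banach \<Rightarrow> 'n::finite dist) \<Rightarrow> real \<Rightarrow> bool" where
  "class_G \<iota> \<sigma> \<longleftrightarrow> dist_space \<iota> \<and>
     (\<exists>C>0. \<forall>l>0. \<forall>f. \<exists>fl. dist_eq (\<iota> fl) (dilate l (\<iota> f)) \<and>
        norm fl \<le> C * l powr \<sigma> * norm f)"

text \<open>Products and principal values of elements of a dual space refer to the functions that these
  elements are: \<open>f \<in> F'\<close> is the function \<open>a\<close> if it acts on the Schwartz functions belonging to \<open>F\<close> by
  integration against \<open>a\<close>.\<close>

definition represents ::
  "('e::banach \<Rightarrow> 'n::finite dist) \<Rightarrow> ('e \<Rightarrow>\<^sub>L real) \<Rightarrow> (real ^ 'n \<Rightarrow> real) \<Rightarrow> bool" where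
  "represents \<iota> f a \<longleftrightarrow>
     (\<forall>r. a absolutely_integrable_on cball 0 r) \<and>
     (\<forall>\<phi>\<in>schwartz. \<forall>h. dist_eq (\<iota> h) (regular_dist \<phi>) \<longrightarrow>
        integrable lebesgue (\<lambda>x. a x * \<phi> x) \<and>
        blinfun_apply f h = (LINT x|lebesgue. a x * \<phi> x))"

definition is_product ::
  "('e::banach \<Rightarrow> 'n::finite dist) \<Rightarrow> ('f::banach \<Rightarrow> 'n dist) \<Rightarrow>
   ('e \<Rightarrow>\<^sub>L real) \<Rightarrow> ('e \<Rightarrow>\<^sub>L real) \<Rightarrow> ('f \<Rightarrow>\<^sub>L real) \<Rightarrow> bool" where
  "is_product \<iota> \<iota>\<^sub>0 f g w \<longleftrightarrow>
     (\<exists>a b. represents \<iota> f a \<and> represents \<iota> g b \<and> represents \<iota>\<^sub>0 w (\<lambda>x. a x * b x))"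

definition riesz_const :: "'n::finite itself \<Rightarrow> real" where
  "riesz_const _ = Gamma ((real CARD('n) + 1) / 2) * pi powr (- (real CARD('n) + 1) / 2)"

definition riesz_truncated ::
  "'n::finite \<Rightarrow> (real ^ 'n \<Rightarrow> real) \<Rightarrow> real \<Rightarrow> real ^ 'n \<Rightarrow> real ^ 'n \<Rightarrow> real" where
  "riesz_truncated j a e x y =
     indicator {y. e < norm y} y * (y $ j / norm y ^ (CARD('n) + 1) * a (x - y))"

text \<open>\<open>b(x) = c\<^sub>n P.V. \<integral> y\<^sub>j / |y|\<^bsup>n+1\<^esup> a(x - y) dy\<close> for almost every \<open>x\<close>.\<close>

definition riesz_transform ::
  "'n::finite \<Rightarrow> (real ^ 'n \<Rightarrow> real) \<Rightarrow> (real ^ 'n \<Rightarrow> real) \<Rightarrow> bool" where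
  "riesz_transform j a b \<longleftrightarrow>
     (AE x in lebesgue.
        (\<forall>e>0. integrable lebesgue (riesz_truncated j a e x)) \<and>
        ((\<lambda>e. riesz_const TYPE('n) * (LINT y|lebesgue. riesz_truncated j a e x y))
           \<longlongrightarrow> b x) (at_right 0))"

definition is_riesz ::
  "('f::banach \<Rightarrow> 'n::finite dist) \<Rightarrow> 'n \<Rightarrow> ('f \<Rightarrow>\<^sub>L real) \<Rightarrow> ('f \<Rightarrow>\<^sub>L real) \<Rightarrow> bool" where
  "is_riesz \<iota>\<^sub>0 j g w \<longleftrightarrow>
     (\<exists>a b. represents \<iota>\<^sub>0 g a \<and> represents \<iota>\<^sub>0 w b \<and> riesz_transform j a b)"

definition heat_kernel :: "real \<Rightarrow> real ^ 'n::finite \<Rightarrow> real" where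
  "heat_kernel t x = (4 * pi * t) powr (- real CARD('n) / 2) * exp (- (norm x)\<^sup>2 / (4 * t))"

definition is_gradU ::
  "('e::banach \<Rightarrow> 'n::finite dist) \<Rightarrow> ('f::banach \<Rightarrow> 'n dist) \<Rightarrow> real \<Rightarrow> 'e \<Rightarrow> 'f ^ 'n \<Rightarrow> bool"
  where
  "is_gradU \<iota> \<iota>\<^sub>0 t f w \<longleftrightarrow>
     (\<forall>j. dist_eq (\<iota>\<^sub>0 (w $ j)) (conv_dist (partials [j] (heat_kernel t)) (\<iota> f)))"

text \<open>If \<open>\<iota>\<^sub>0\<close> is injective on distributions, at most one \<open>w\<close> satisfies \<^const>\<open>is_gradU\<close>. The norm of
  \<open>'f ^ 'n\<close> is the Euclidean norm of the vector of component norms.\<close>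

definition gradU ::
  "('e::banach \<Rightarrow> 'n::finite dist) \<Rightarrow> ('f::banach \<Rightarrow> 'n dist) \<Rightarrow> real \<Rightarrow> 'e \<Rightarrow> 'f ^ 'n" where
  "gradU \<iota> \<iota>\<^sub>0 t f = (THE w. is_gradU \<iota> \<iota>\<^sub>0 t f w)"

definition gradU_dual ::
  "('e::banach \<Rightarrow> 'n::finite dist) \<Rightarrow> ('f::banach \<Rightarrow> 'n dist) \<Rightarrow>
   real \<Rightarrow> 'n \<Rightarrow> ('f \<Rightarrow>\<^sub>L real) \<Rightarrow> ('e \<Rightarrow>\<^sub>L real)" where
  "gradU_dual \<iota> \<iota>\<^sub>0 t j g = Blinfun (\<lambda>h. - blinfun_apply g (gradU \<iota> \<iota>\<^sub>0 t h $ j))"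

definition divU_dual ::
  "('e::banach \<Rightarrow> 'n::finite dist) \<Rightarrow> ('f::banach \<Rightarrow> 'n dist) \<Rightarrow>
   real \<Rightarrow> ('f \<Rightarrow>\<^sub>L real) ^ 'n ^ 'n \<Rightarrow> ('e \<Rightarrow>\<^sub>L real) ^ 'n" where
  "divU_dual \<iota> \<iota>\<^sub>0 t M = (\<chi> k. \<Sum>j\<in>UNIV. gradU_dual \<iota> \<iota>\<^sub>0 t j (M $ k $ j))"

definition tensor :: "('a \<Rightarrow> 'a \<Rightarrow> 'b) \<Rightarrow> 'a ^ 'n \<Rightarrow> 'a ^ 'n \<Rightarrow> 'b ^ 'n ^ 'n" where
  "tensor m u v = (\<chi> l j. m (u $ l) (v $ j))"

text \<open>The matrix operator with entries \<open>\<delta>\<^sub>k\<^sub>l + R\<^sub>k R\<^sub>l\<close>, multiplying matrices from the left. The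
  divergence \<^const>\<open>divU_dual\<close> therefore contracts the second index (contracting the first would
  give zero, gradients being annihilated by the Leray projector).\<close>

definition leray :: "('n \<Rightarrow> 'b \<Rightarrow> 'b) \<Rightarrow> 'b::real_vector ^ 'n ^ 'n \<Rightarrow> 'b ^ 'n ^ 'n" where
  "leray R M = (\<chi> k j. \<Sum>l\<in>UNIV. (if k = l then M $ l $ j else 0) + R k (R l (M $ l $ j)))"

definition B_integrand ::
  "('e::banach \<Rightarrow> 'n::finite dist) \<Rightarrow> ('f::banach \<Rightarrow> 'n dist) \<Rightarrow>
   ('n \<Rightarrow> ('f \<Rightarrow>\<^sub>L real) \<Rightarrow> ('f \<Rightarrow>\<^sub>L real)) \<Rightarrow>
   (('e \<Rightarrow>\<^sub>L real) \<Rightarrow> ('e \<Rightarrow>\<^sub>L real) \<Rightarrow> ('f \<Rightarrow>\<^sub>L real)) \<Rightarrow>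
   (real \<Rightarrow> ('e \<Rightarrow>\<^sub>L real) ^ 'n) \<Rightarrow> (real \<Rightarrow> ('e \<Rightarrow>\<^sub>L real) ^ 'n) \<Rightarrow>
   real \<Rightarrow> real \<Rightarrow> ('e \<Rightarrow>\<^sub>L real) ^ 'n" where
  "B_integrand \<iota> \<iota>\<^sub>0 R m u v t s = divU_dual \<iota> \<iota>\<^sub>0 (t - s) (leray R (tensor m (u s) (v s)))"

text \<open>\<open>b = B(u,v)(t)\<close> in the weak sense.\<close>

definition is_B ::
  "('e::banach \<Rightarrow> 'n::finite dist) \<Rightarrow> ('f::banach \<Rightarrow> 'n dist) \<Rightarrow>
   ('n \<Rightarrow> ('f \<Rightarrow>\<^sub>L real) \<Rightarrow> ('f \<Rightarrow>\<^sub>L real)) \<Rightarrow>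
   (('e \<Rightarrow>\<^sub>L real) \<Rightarrow> ('e \<Rightarrow>\<^sub>L real) \<Rightarrow> ('f \<Rightarrow>\<^sub>L real)) \<Rightarrow>
   (real \<Rightarrow> ('e \<Rightarrow>\<^sub>L real) ^ 'n) \<Rightarrow> (real \<Rightarrow> ('e \<Rightarrow>\<^sub>L real) ^ 'n) \<Rightarrow>
   real \<Rightarrow> ('e \<Rightarrow>\<^sub>L real) ^ 'n \<Rightarrow> bool" where
  "is_B \<iota> \<iota>\<^sub>0 R m u v t b \<longleftrightarrow>
     (\<forall>k h. set_integrable lebesgue {0<..<t}
              (\<lambda>s. blinfun_apply (B_integrand \<iota> \<iota>\<^sub>0 R m u v t s $ k) h) \<and>
            blinfun_apply (b $ k) h =
              - (LINT s:{0<..<t}|lebesgue. blinfun_apply (B_integrand \<iota> \<iota>\<^sub>0 R m u v t s $ k) h))"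

definition B ::
  "('e::banach \<Rightarrow> 'n::finite dist) \<Rightarrow> ('f::banach \<Rightarrow> 'n dist) \<Rightarrow>
   ('n \<Rightarrow> ('f \<Rightarrow>\<^sub>L real) \<Rightarrow> ('f \<Rightarrow>\<^sub>L real)) \<Rightarrow>
   (('e \<Rightarrow>\<^sub>L real) \<Rightarrow> ('e \<Rightarrow>\<^sub>L real) \<Rightarrow> ('f \<Rightarrow>\<^sub>L real)) \<Rightarrow>
   (real \<Rightarrow> ('e \<Rightarrow>\<^sub>L real) ^ 'n) \<Rightarrow> (real \<Rightarrow> ('e \<Rightarrow>\<^sub>L real) ^ 'n) \<Rightarrow>
   real \<Rightarrow> ('e \<Rightarrow>\<^sub>L real) ^ 'n" where
  "B \<iota> \<iota>\<^sub>0 R m u v t = (THE b. is_B \<iota> \<iota>\<^sub>0 R m u v t b)"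

definition time_interval :: "ereal \<Rightarrow> real set" where
  "time_interval T = {t. 0 < t \<and> ereal t < T}"

text \<open>Bochner's class: \<open>u\<close> is an almost everywhere limit of simple functions. Borel measurability
  would be too weak, as the values need not lie in a separable space.\<close>

definition Linf :: "ereal \<Rightarrow> (real \<Rightarrow> 'b::real_normed_vector) set" where
  "Linf T = {u.
     (\<exists>s. (\<forall>k::nat. simple_function (lebesgue_on (time_interval T)) (s k)) \<and>
          (AE t in lebesgue_on (time_interval T). (\<lambda>k. s k t) \<longlonglongrightarrow> u t)) \<and>
     (\<exists>c. AE t in lebesgue_on (time_interval T). norm (u t) \<le> c)}"

definition Linf_norm :: "ereal \<Rightarrow> (real \<Rightarrow> 'b::real_normed_vector) \<Rightarrow> ereal" where
  "Linf_norm T u = esssup (lebesgue_on (time_interval T)) (\<lambda>t. ereal (norm (u t)))"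

text \<open>\<open>R j\<close> is the \<open>j\<close>-th Riesz transform on \<open>E\<^sub>0'\<close> and \<open>m\<close> is the multiplication
  \<open>E' \<times> E' \<rightarrow> E\<^sub>0'\<close>. Both are determined by these conditions as soon as \<open>E\<close> and \<open>E\<^sub>0\<close>
  contain the Schwartz functions and these are dense in \<open>E\<^sub>0\<close>, which is not assumed; hence linearity
  is stated as part of the conditions.\<close>

definition riesz_bounded ::
  "('f::banach \<Rightarrow> 'n::finite dist) \<Rightarrow> ('n \<Rightarrow> ('f \<Rightarrow>\<^sub>L real) \<Rightarrow> ('f \<Rightarrow>\<^sub>L real)) \<Rightarrow> bool" where
  "riesz_bounded \<iota>\<^sub>0 R \<longleftrightarrow> (\<forall>j. bounded_linear (R j) \<and> (\<forall>g. is_riesz \<iota>\<^sub>0 j g (R j g)))"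

definition product_bounded ::
  "('e::banach \<Rightarrow> 'n::finite dist) \<Rightarrow> ('f::banach \<Rightarrow> 'n dist) \<Rightarrow>
   (('e \<Rightarrow>\<^sub>L real) \<Rightarrow> ('e \<Rightarrow>\<^sub>L real) \<Rightarrow> ('f \<Rightarrow>\<^sub>L real)) \<Rightarrow> bool" where
  "product_bounded \<iota> \<iota>\<^sub>0 m \<longleftrightarrow>
     bilinear m \<and> (\<forall>f g. is_product \<iota> \<iota>\<^sub>0 f g (m f g)) \<and>
     (\<exists>C>0. \<forall>f g. norm (m f g) \<le> C * norm f * norm g)"

text \<open>The last condition says that \<open>s \<mapsto> \<nabla>U(s)f\<close> is weakly measurable as a map into \<open>E\<^sub>0\<close>, without
  which the weak integral defining \<open>B(u,v)\<close> makes no sense.\<close>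

definition gradU_integrable ::
  "('e::banach \<Rightarrow> 'n::finite dist) \<Rightarrow> ('f::banach \<Rightarrow> 'n dist) \<Rightarrow> real \<Rightarrow> real \<Rightarrow> bool" where
  "gradU_integrable \<iota> \<iota>\<^sub>0 \<sigma> \<sigma>\<^sub>0 \<longleftrightarrow>
     (\<forall>t>0. (\<forall>f. \<exists>w. is_gradU \<iota> \<iota>\<^sub>0 t f w) \<and> bounded_linear (gradU \<iota> \<iota>\<^sub>0 t)) \<and>
     (\<exists>C>0. \<forall>f. (\<integral>\<^sup>+s\<in>{0<..}. ennreal (s powr ((\<sigma>\<^sub>0 - \<sigma>) / 2 - 1 / 2) * norm (gradU \<iota> \<iota>\<^sub>0 s f))
                    \<partial>lebesgue) \<le> ennreal (C * norm f)) \<and>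
     (\<forall>f (g :: 'f \<Rightarrow>\<^sub>L real) j. (\<lambda>s. blinfun_apply g (gradU \<iota> \<iota>\<^sub>0 s f $ j))
                 \<in> borel_measurable (lebesgue_on {0<..}))"

end

theory Submission
  imports Defs
begin

text \<open>At the critical exponent the time weight in the integrability hypothesis is \<open>s\<^sup>0 = 1\<close>. The matrix
  field \<open>G(s) = \<P>(u \<otimes> v)(s)\<close> depends bilinearly and continuously on \<open>(u(s), v(s))\<close>, so
  pairing with \<open>h\<close> gives \<open>\<bar>\<langle>\<nabla>U(t - s) \<sqdot> G(s), h\<rangle>\<bar> \<le> c \<parallel>u(s)\<parallel> \<parallel>v(s)\<parallel> \<parallel>\<nabla>U(t - s) h\<parallel>\<close>, and after
  the reflection \<open>s \<mapsto> t - s\<close> the hypothesis bounds the integral by \<open>c \<parallel>u\<parallel>\<^sub>\<infinity> \<parallel>v\<parallel>\<^sub>\<infinity> \<parallel>h\<parallel>\<close>. Measurability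
  of the integrand is obtained by approximating \<open>G\<close> by simple functions, for which it reduces to the
  weak measurability of \<open>s \<mapsto> \<nabla>U(s) h\<close>. As \<open>s \<mapsto> \<parallel>\<nabla>U(s) h\<parallel>\<close> itself need not be measurable, its
  integral is only used as a monotone upper bound.\<close>

subsection \<open>Bounded linear and bilinear maps into vectors\<close>

lemma norm_vec_le_sum:
  fixes x :: "'a::real_normed_vector ^ 'n"
  shows "norm x \<le> (\<Sum>i\<in>UNIV. norm (x $ i))"
  unfolding norm_vec_def by (rule L2_set_le_sum) simp

lemma bounded_linear_vec_lambda:
  fixes f :: "'i::finite \<Rightarrow> 'a::real_normed_vector \<Rightarrow> 'b::real_normed_vector"
  assumes f: "\<And>i. bounded_linear (f i)"
  shows "bounded_linear (\<lambda>x. \<chi> i. f i x)"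
proof (rule bounded_linear_intro)
  fix x y r
  show "(\<chi> i. f i (x + y)) = (\<chi> i. f i x) + (\<chi> i. f i y)"
    by (simp add: vec_eq_iff linear_add[OF bounded_linear.linear[OF f]])
  show "(\<chi> i. f i (r *\<^sub>R x)) = r *\<^sub>R (\<chi> i. f i x)"
    by (simp add: vec_eq_iff linear_scale[OF bounded_linear.linear[OF f]])
next
  fix x
  have "norm (\<chi> i. f i x) \<le> (\<Sum>i\<in>UNIV. norm (f i x))"
    using norm_vec_le_sum[of "\<chi> i. f i x"] by simp
  also have "\<dots> \<le> (\<Sum>i\<in>UNIV. norm x * onorm (f i))"
    by (intro sum_mono) (metis onorm[OF f] mult.commute)
  finally show "norm (\<chi> i. f i x) \<le> norm x * (\<Sum>i\<in>UNIV. onorm (f i))"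
    by (simp add: sum_distrib_left)
qed

text \<open>Every entry of the result is a finite sum of matrix entries to which the identity or two
  Riesz transforms are applied, so boundedness of the Riesz transforms is enough.\<close>

lemma bounded_linear_leray:
  assumes R: "\<And>j. bounded_linear (R j)"
  shows "bounded_linear (leray R)"
proof -
  have nth: "bounded_linear (\<lambda>M. M $ l $ j)" for l j
    by (rule bounded_linear_compose[OF bounded_linear_vec_nth bounded_linear_vec_nth])
  have "bounded_linear (\<lambda>M. (if k = l then M $ l $ j else 0) + R k (R l (M $ l $ j)))" for k l j
    by (cases "k = l")
      (simp_all add: bounded_linear_add bounded_linear_compose[OF R] nth)
  then show ?thesis
    unfolding leray_def[abs_def]
    by (intro bounded_linear_vec_lambda bounded_linear_sum)
qed

text \<open>Each entry has norm at most \<open>norm a * norm b * K\<close>, and the norm of a matrix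
  is at most the sum of the norms of its entries; the constant is thus \<open>K\<close> times the
  number of entries.\<close>

lemma bounded_bilinear_tensor:
  assumes "bounded_bilinear m"
  shows "bounded_bilinear (tensor m)"
proof -
  interpret bounded_bilinear m by fact
  obtain K where K: "K > 0" "\<And>a b. norm (m a b) \<le> norm a * norm b * K"
    using pos_bounded by blast
  show ?thesis
  proof
    fix a a' and b b' :: "_ ^ 'd" and r
    show "tensor m (a + a') b = tensor m a b + tensor m a' b"
      "tensor m a (b + b') = tensor m a b + tensor m a b'"
      "tensor m (r *\<^sub>R a) b = r *\<^sub>R tensor m a b"
      "tensor m a (r *\<^sub>R b) = r *\<^sub>R tensor m a b"
      by (simp_all add: tensor_def vec_eq_iff add_left add_right scaleR_left scaleR_right)
  next
    have "norm (tensor m a b) \<le> norm a * norm b * (\<Sum>l\<in>(UNIV::'d set). \<Sum>j\<in>(UNIV::'d set). K)"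
      for a b :: "_ ^ 'd"
    proof -
      have "norm (tensor m a b) \<le> (\<Sum>l\<in>UNIV. norm (tensor m a b $ l))"
        by (rule norm_vec_le_sum)
      also have "\<dots> \<le> (\<Sum>l\<in>UNIV. \<Sum>j\<in>UNIV. norm (tensor m a b $ l $ j))"
        by (intro sum_mono norm_vec_le_sum)
      also have "\<dots> \<le> (\<Sum>l\<in>(UNIV::'d set). \<Sum>j\<in>(UNIV::'d set). norm a * norm b * K)"
      proof (intro sum_mono)
        fix l j
        have "norm (m (a $ l) (b $ j)) \<le> norm (a $ l) * norm (b $ j) * K"
          by (rule K)
        also have "\<dots> \<le> norm a * norm b * K"
          using K(1) by (intro mult_right_mono mult_mono Finite_Cartesian_Product.norm_nth_le) auto
        finally show "norm (tensor m a b $ l $ j) \<le> norm a * norm b * K"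
          by (simp add: tensor_def)
      qed
      finally show ?thesis by (simp add: mult_ac)
    qed
    then show "\<exists>K. \<forall>a b. norm (tensor m a b) \<le> norm (a :: _ ^ 'd) * norm b * K" by blast
  qed
qed

lemma bounded_bilinear_linear_compose:
  assumes "bounded_bilinear p" and "bounded_linear f"
  shows "bounded_bilinear (\<lambda>a b. f (p a b))"
proof -
  interpret p: bounded_bilinear p by fact
  interpret f: bounded_linear f by fact
  obtain K where K: "\<And>a b. norm (p a b) \<le> norm a * norm b * K"
    using p.bounded by blast
  obtain L where L: "L \<ge> 0" "\<And>x. norm (f x) \<le> norm x * L"
    using f.nonneg_bounded by blast
  show ?thesis
  proof
    have "norm (f (p a b)) \<le> norm a * norm b * (K * L)" for a b
      using L(2)[of "p a b"] mult_right_mono[OF K L(1)] by (auto simp: mult.assoc intro: order_trans)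
    then show "\<exists>K. \<forall>a b. norm (f (p a b)) \<le> norm a * norm b * K" by blast
  qed (simp_all add: p.add_left p.add_right p.scaleR_left p.scaleR_right f.add f.scaleR)
qed

lemma bounded_bilinear_if_product_bounded:
  assumes "product_bounded \<iota> \<iota>\<^sub>0 m"
  shows "bounded_bilinear m"
proof -
  obtain C where bil: "bilinear m" and C: "\<And>f g. norm (m f g) \<le> C * norm f * norm g"
    using assms unfolding product_bounded_def by blast
  show ?thesis
  proof
    show "\<exists>K. \<forall>a b. norm (m a b) \<le> norm a * norm b * K"
      using C by (metis mult.assoc mult.commute)
  qed (use bil in \<open>simp_all add: bilinear_ladd bilinear_radd bilinear_lmul bilinear_rmul\<close>)
qed

subsection \<open>Bochner measurability\<close>

text \<open>The measurability half of \<open>Linf\<close>, on an arbitrary set of times, so that it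
  can be restricted to \<open>{0<..<t}\<close> and carried through bilinear maps.\<close>

definition strongly_measurable_on :: "real set \<Rightarrow> (real \<Rightarrow> 'b::topological_space) \<Rightarrow> bool" where
  "strongly_measurable_on S u \<longleftrightarrow>
     (\<exists>s. (\<forall>k::nat. simple_function (lebesgue_on S) (s k)) \<and>
          (AE t in lebesgue_on S. (\<lambda>k. s k t) \<longlonglongrightarrow> u t))"

text \<open>The pointwise \<open>lim\<close> is measurable, and by completeness of Lebesgue measure
  a change on a null set does no harm. Extension by zero moves the argument from \<open>S\<close> to
  the whole line.\<close>

lemma borel_measurable_AE_limit:
  fixes g :: "real \<Rightarrow> real"
  assumes S: "S \<in> sets lebesgue"
    and f: "\<And>k. f k \<in> borel_measurable (lebesgue_on S)"
    and lim: "AE x in lebesgue_on S. (\<lambda>k::nat. f k x) \<longlonglongrightarrow> g x"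
  shows "g \<in> borel_measurable (lebesgue_on S)"
proof -
  have "(\<lambda>x. lim (\<lambda>k. f k x)) \<in> borel_measurable (lebesgue_on S)"
    by (rule borel_measurable_lim_metric) (rule f)
  then have "(\<lambda>x. indicator S x *\<^sub>R lim (\<lambda>k. f k x)) \<in> borel_measurable lebesgue"
    using S by (simp add: borel_measurable_restrict_space_iff)
  moreover have "AE x in lebesgue. indicator S x *\<^sub>R lim (\<lambda>k. f k x) = indicator S x *\<^sub>R g x"
    using lim S by (auto simp: AE_restrict_space_iff limI elim!: eventually_mono split: split_indicator)
  ultimately have "(\<lambda>x. indicator S x *\<^sub>R g x) \<in> borel_measurable lebesgue"
    by (rule borel_measurable_AE)
  then show ?thesis using S by (simp add: borel_measurable_restrict_space_iff)
qed

lemma strongly_measurable_on_subset: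
  assumes u: "strongly_measurable_on S u" and "A \<subseteq> S" "A \<in> sets lebesgue" "S \<in> sets lebesgue"
  shows "strongly_measurable_on A u"
proof -
  obtain s where s: "\<And>k::nat. simple_function (lebesgue_on S) (s k)"
    and lim: "AE t in lebesgue_on S. (\<lambda>k. s k t) \<longlonglongrightarrow> u t"
    using u unfolding strongly_measurable_on_def by blast
  have "simple_function (lebesgue_on A) (s k)" for k
  proof -
    have meas: "s k \<in> lebesgue_on A \<rightarrow>\<^sub>M count_space UNIV"
      using measurable_restrict_mono[OF measurable_simple_function[OF s]] assms by blast
    have "finite (s k ` S)"
      using simple_functionD(1)[OF s[of k]] by simp
    then have "finite (s k ` A)"
      using image_mono[OF \<open>A \<subseteq> S\<close>] by (rule rev_finite_subset)
    moreover have "s k -` {x} \<inter> A \<in> sets (lebesgue_on A)" for x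
      using measurable_sets[OF meas, of "{x}"] by simp
    ultimately show ?thesis by (simp add: simple_function_def)
  qed
  moreover have "AE t in lebesgue_on A. (\<lambda>k. s k t) \<longlonglongrightarrow> u t"
    using lim assms by (auto simp: AE_restrict_space_iff elim!: eventually_mono)
  ultimately show ?thesis unfolding strongly_measurable_on_def by blast
qed

text \<open>Two simple functions together take finitely many values, so their product is simple
  again; continuity of the product handles the limit.\<close>

lemma (in bounded_bilinear) strongly_measurable_on:
  assumes "strongly_measurable_on S u" "strongly_measurable_on S v"
  shows "strongly_measurable_on S (\<lambda>t. prod (u t) (v t))"
proof -
  obtain s where s: "\<And>k::nat. simple_function (lebesgue_on S) (s k)"
    and u: "AE t in lebesgue_on S. (\<lambda>k. s k t) \<longlonglongrightarrow> u t"
    using assms(1) unfolding strongly_measurable_on_def by blast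
  obtain s' where s': "\<And>k::nat. simple_function (lebesgue_on S) (s' k)"
    and v: "AE t in lebesgue_on S. (\<lambda>k. s' k t) \<longlonglongrightarrow> v t"
    using assms(2) unfolding strongly_measurable_on_def by blast
  have "simple_function (lebesgue_on S) (\<lambda>t. prod (s k t) (s' k t))" for k
    by (rule simple_function_compose2[OF s s'])
  moreover have "AE t in lebesgue_on S. (\<lambda>k. prod (s k t) (s' k t)) \<longlonglongrightarrow> prod (u t) (v t)"
    using u v by eventually_elim (rule tendsto)
  ultimately show ?thesis unfolding strongly_measurable_on_def
    by (intro exI[of _ "\<lambda>k t. prod (s k t) (s' k t)"] conjI allI)
qed

text \<open>A Caratheodory argument: for simple \<open>G\<close> the function is pieced together
  from finitely many of the measurable functions \<open>a y\<close>, and continuity in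
  \<open>y\<close> passes to the limit. In the application, \<open>y\<close> is the matrix field and
  \<open>a y s\<close> its pairing with a component of the gradient, which is only weakly measurable
  in time.\<close>

lemma borel_measurable_strongly_measurable_apply:
  fixes G :: "real \<Rightarrow> 'a::topological_space"
  assumes S: "S \<in> sets lebesgue"
    and G: "strongly_measurable_on S G"
    and meas: "\<And>y. (\<lambda>s. a y s) \<in> borel_measurable (lebesgue_on S)"
    and cont: "\<And>s. continuous_on UNIV (\<lambda>y. a y s)"
  shows "(\<lambda>s. a (G s) s :: real) \<in> borel_measurable (lebesgue_on S)"
proof -
  obtain f where f: "\<And>k::nat. simple_function (lebesgue_on S) (f k)"
    and lim: "AE t in lebesgue_on S. (\<lambda>k. f k t) \<longlonglongrightarrow> G t"
    using G unfolding strongly_measurable_on_def by blast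
  show ?thesis
  proof (rule borel_measurable_AE_limit[OF S])
    fix k
    have fin: "finite (f k ` space (lebesgue_on S))"
      by (rule simple_functionD(1)[OF f])
    \<comment> \<open>The target is the finite range of \<open>f k\<close> with the discrete
      structure, over which the functions \<open>a y\<close> may be glued together.\<close>
    have "f k \<in> lebesgue_on S \<rightarrow>\<^sub>M count_space (f k ` space (lebesgue_on S))"
      using f[of k] fin by (subst measurable_count_space_eq2) (auto simp: simple_function_def)
    then show "(\<lambda>s. a (f k s) s) \<in> borel_measurable (lebesgue_on S)"
      by (rule measurable_compose_countable'[OF meas]) (rule countable_finite[OF fin])
  next
    show "AE s in lebesgue_on S. (\<lambda>k. a (f k s) s) \<longlonglongrightarrow> a (G s) s"
      using lim by eventually_elim (rule continuous_on_tendsto_compose[OF cont]; simp)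
  qed
qed

lemma borel_measurable_norm_strongly_measurable:
  fixes u :: "real \<Rightarrow> 'b::real_normed_vector"
  assumes "S \<in> sets lebesgue" "strongly_measurable_on S u"
  shows "(\<lambda>t. norm (u t)) \<in> borel_measurable (lebesgue_on S)"
  by (rule borel_measurable_strongly_measurable_apply[OF assms])
    (simp_all add: continuous_on_norm_id)

subsection \<open>Essentially bounded functions of time\<close>

lemma sets_time_interval: "time_interval T \<in> sets lebesgue"
proof -
  have "time_interval T = {0<..} \<inter> {t. ereal t < T}"
    by (auto simp: time_interval_def)
  moreover have "open {t. ereal t < T}"
    by (intro open_Collect_less continuous_intros)
  ultimately have "open (time_interval T)" by (simp add: open_Int)
  then show ?thesis by simp
qed

lemma time_interval_subset: "t \<in> time_interval T \<Longrightarrow> {0<..<t} \<subseteq> time_interval T"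
  by (auto simp: time_interval_def) (metis less_ereal.simps(1) order.strict_trans)

lemma strongly_measurable_on_Linf:
  "u \<in> Linf T \<Longrightarrow> strongly_measurable_on (time_interval T) u"
  unfolding Linf_def strongly_measurable_on_def by blast

text \<open>Replaces the extended-real essential supremum by a nonnegative real bound, so that the
  estimates can be carried out with real numbers.\<close>

lemma Linf_norm_real:
  fixes u :: "real \<Rightarrow> 'b::real_normed_vector"
  assumes T: "T > 0" and u: "u \<in> Linf T"
  obtains c where "c \<ge> 0" "Linf_norm T u = ereal c"
    "AE t in lebesgue_on (time_interval T). norm (u t) \<le> c"
proof -
  let ?M = "lebesgue_on (time_interval T)"
  \<comment> \<open>For a function that is not measurable, \<open>esssup\<close> defaults to the top
    element.\<close>
  have meas: "(\<lambda>t. ereal (norm (u t))) \<in> borel_measurable ?M"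
    using borel_measurable_norm_strongly_measurable[OF sets_time_interval strongly_measurable_on_Linf[OF u]] by simp
  obtain c where "AE t in ?M. norm (u t) \<le> c"
    using u unfolding Linf_def by blast
  then have le: "Linf_norm T u \<le> ereal c"
    unfolding Linf_norm_def by (intro esssup_I meas) simp
  have ae: "AE t in ?M. ereal (norm (u t)) \<le> Linf_norm T u"
    unfolding Linf_norm_def by (rule esssup_AE)
  have ge: "Linf_norm T u \<ge> 0"
  proof (rule ccontr)
    \<comment> \<open>On a null space \<open>esssup\<close> would be minus infinity, so positivity
      of \<open>T\<close> matters: a negative value would make the norm negative almost everywhere,
      hence some interval \<open>{0<..<t}\<close> of positive length a null set.\<close>
    assume neg: "\<not> Linf_norm T u \<ge> 0"
    obtain t where t: "0 < t" "ereal t < T"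
      using T ereal_dense2[of 0 T] by (auto simp: zero_ereal_def)
    then have tT: "t \<in> time_interval T" by (simp add: time_interval_def)
    have "AE s in ?M. False"
      using ae by eventually_elim (use neg in \<open>meson ereal_less_eq(5) norm_ge_zero order_trans\<close>)
    then have "AE s in lebesgue. s \<notin> {0<..<t}"
      using sets_time_interval[of T] time_interval_subset[OF tT]
      by (auto simp: AE_restrict_space_iff elim!: eventually_mono)
    then have "emeasure lebesgue {0<..<t} = 0"
      by (subst (asm) AE_iff_measurable[of "{0<..<t}"]) auto
    then show False using t by simp
  qed
  from le ge obtain d where d: "Linf_norm T u = ereal d"
    by (cases "Linf_norm T u") auto
  show thesis
    by (rule that[of d]) (use ge ae d in auto)
qed

subsection \<open>Weak integrals\<close>

text \<open>The exceptional set lies in a null set \<open>N\<close>, and the affine change of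
  variables leaves the integral of the indicator of \<open>N\<close> equal to zero.\<close>

lemma AE_lebesgue_reflect:
  fixes t :: real
  assumes "AE s in lebesgue. P s"
  shows "AE s in lebesgue. P (t - s)"
proof -
  obtain N where N: "N \<in> null_sets lebesgue" "{s. \<not> P s} \<subseteq> N"
    using assms by (auto simp: eventually_ae_filter)
  have [measurable]: "(\<lambda>s. t + (- 1) * s) \<in> lebesgue \<rightarrow>\<^sub>M lebesgue"
    using lebesgue_affine_measurable[of "\<lambda>_. - 1" t] by simp
  have [measurable]: "N \<in> sets lebesgue" using N by auto
  have meas: "(\<lambda>s. indicator N (t + (- 1) * s) :: ennreal) \<in> borel_measurable lebesgue"
    by measurable
  have "(\<integral>\<^sup>+s. indicator N (t + (- 1) * s) \<partial>lebesgue) = (\<integral>\<^sup>+s. indicator N s \<partial>lebesgue)"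
    by (subst (2) nn_integral_real_affine_lebesgue[of _ "- 1" t]) auto
  also have "\<dots> = 0" using null_setsD1[OF N(1)] by (subst nn_integral_indicator) auto
  finally have "AE s in lebesgue. indicator N (t + (- 1) * s) = (0::ennreal)"
    by (subst (asm) nn_integral_0_iff_AE[OF meas])
  then show ?thesis
    by eventually_elim (use N in \<open>auto simp: indicator_eq_0_iff\<close>)
qed

text \<open>The reflection is performed on the measurable side \<open>f\<close>. The function
  \<open>N\<close>, possibly not measurable, enters only through monotonicity of the upper
  integral.\<close>

lemma nn_integral_reflect_le:
  fixes f N :: "real \<Rightarrow> real"
  assumes f: "f \<in> borel_measurable (lebesgue_on {0<..<t})"
    and bound: "AE s in lebesgue_on {0<..<t}. \<bar>f s\<bar> \<le> N (t - s)"
  shows "(\<integral>\<^sup>+s. ennreal \<bar>f s\<bar> \<partial>lebesgue_on {0<..<t}) \<le> (\<integral>\<^sup>+s\<in>{0<..}. ennreal (N s) \<partial>lebesgue)"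
proof -
  define q where "q s = ennreal \<bar>indicator {0<..<t} s *\<^sub>R f s\<bar>" for s
  have q: "q \<in> borel_measurable lebesgue"
    using f by (auto simp: q_def[abs_def] borel_measurable_restrict_space_iff)
  have "(\<integral>\<^sup>+s. ennreal \<bar>f s\<bar> \<partial>lebesgue_on {0<..<t}) = (\<integral>\<^sup>+s. q s \<partial>lebesgue)"
    by (subst nn_integral_restrict_space)
      (auto simp: q_def intro!: nn_integral_cong split: split_indicator)
  also have "\<dots> = (\<integral>\<^sup>+s. q (t - s) \<partial>lebesgue)"
    by (subst nn_integral_real_affine_lebesgue[OF q, of "- 1" t]) auto
  also have "\<dots> \<le> (\<integral>\<^sup>+s\<in>{0<..}. ennreal (N s) \<partial>lebesgue)"
  proof (rule nn_integral_mono_AE)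
    have "AE s in lebesgue. s \<in> {0<..<t} \<longrightarrow> \<bar>f s\<bar> \<le> N (t - s)"
      using bound by (simp add: AE_restrict_space_iff)
    from AE_lebesgue_reflect[OF this, of t]
    show "AE s in lebesgue. q (t - s) \<le> ennreal (N s) * indicator {0<..} s"
      \<comment> \<open>The interval \<open>{0<..<t}\<close> is its own image under the reflection;
        outside it the left side vanishes.\<close>
      by eventually_elim (auto simp: q_def intro: ennreal_leI split: split_indicator)
  qed
  finally show ?thesis .
qed

text \<open>The bound on the time integral serves twice: it makes each \<open>F s h\<close>
  integrable in \<open>s\<close>, and it bounds the functional obtained by integration. The minus
  sign is the one in \<open>is_B\<close>.\<close>

lemma weak_integral_exists:
  fixes F :: "real \<Rightarrow> 'e::real_normed_vector \<Rightarrow> real"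
  assumes S: "S \<in> sets lebesgue"
    and lin: "\<And>s. s \<in> S \<Longrightarrow> linear (F s)"
    and meas: "\<And>h. (\<lambda>s. F s h) \<in> borel_measurable (lebesgue_on S)"
    and D: "D \<ge> 0"
    and bound: "\<And>h. (\<integral>\<^sup>+s. ennreal \<bar>F s h\<bar> \<partial>lebesgue_on S) \<le> ennreal (D * norm h)"
  obtains b where "norm b \<le> D"
    "\<And>h. set_integrable lebesgue S (\<lambda>s. F s h)"
    "\<And>h. blinfun_apply b h = - (LINT s:S|lebesgue. F s h)"
proof -
  have int: "integrable (lebesgue_on S) (\<lambda>s. F s h)" for h
    using meas[of h] bound[of h] by (intro integrableI_bounded) (auto simp: le_less_trans)
  define I where "I h = - (LINT s|lebesgue_on S. F s h)" for h
  have I_bound: "\<bar>I h\<bar> \<le> D * norm h" for h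
  proof -
    have "ennreal \<bar>I h\<bar> \<le> (\<integral>\<^sup>+s. ennreal \<bar>F s h\<bar> \<partial>lebesgue_on S)"
      using integral_norm_bound_ennreal[OF int[of h]] by (simp add: I_def)
    also note bound
    finally show ?thesis using D by (simp add: ennreal_le_iff)
  qed
  have "bounded_linear I"
  proof (rule bounded_linear_intro)
    fix h h' r
    have "(LINT s|lebesgue_on S. F s (h + h')) = (LINT s|lebesgue_on S. F s h + F s h')"
      by (rule Bochner_Integration.integral_cong) (auto simp: linear_add[OF lin])
    then show "I (h + h') = I h + I h'"
      by (simp add: I_def int)
    have "(LINT s|lebesgue_on S. F s (r *\<^sub>R h)) = (LINT s|lebesgue_on S. r * F s h)"
      by (rule Bochner_Integration.integral_cong) (auto simp: linear_scale[OF lin])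
    then show "I (r *\<^sub>R h) = r *\<^sub>R I h"
      by (simp add: I_def)
  next
    show "norm (I h) \<le> norm h * D" for h
      using I_bound[of h] by (simp add: mult.commute)
  qed
  then have I_apply: "blinfun_apply (Blinfun I) = I"
    by (rule bounded_linear_Blinfun_apply)
  show thesis
  proof (rule that)
    show "norm (Blinfun I) \<le> D"
      by (rule norm_blinfun_bound[OF D]) (simp add: I_apply I_bound)
    show "set_integrable lebesgue S (\<lambda>s. F s h)" for h
      using int[of h] S by (simp add: set_integrable_def integrable_restrict_space)
    show "blinfun_apply (Blinfun I) h = - (LINT s:S|lebesgue. F s h)" for h
      using S by (simp add: I_apply I_def set_lebesgue_integral_def integral_restrict_space)
  qed
qed

section \<open>The bilinear operator and its uniform bound\<close>

lemma B_eqI: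
  assumes "is_B \<iota> \<iota>\<^sub>0 R m u v t b"
  shows "B \<iota> \<iota>\<^sub>0 R m u v t = b"
  unfolding B_def
\<comment> \<open>The relation prescribes the value of every component at every \<open>h\<close>, so
  it has at most one solution.\<close>
proof (rule the_equality[where P = "is_B \<iota> \<iota>\<^sub>0 R m u v t", OF assms])
  fix b' assume "is_B \<iota> \<iota>\<^sub>0 R m u v t b'"
  with assms show "b' = b"
    unfolding is_B_def vec_eq_iff by (metis blinfun_eqI)
qed

text \<open>\<open>Blinfun\<close> can be evaluated as the given function once that function is
  known to be bounded and linear; boundedness of the gradient at time \<open>t - s\<close> supplies
  this, which makes the formula available for \<open>s < t\<close>.\<close>

lemma B_integrand_apply:
  assumes lin: "bounded_linear (gradU \<iota> \<iota>\<^sub>0 (t - s))"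
  shows "blinfun_apply (B_integrand \<iota> \<iota>\<^sub>0 R m u v t s $ k) h =
    (\<Sum>j\<in>UNIV. - blinfun_apply (leray R (tensor m (u s) (v s)) $ k $ j) (gradU \<iota> \<iota>\<^sub>0 (t - s) h $ j))"
proof -
  have bl: "bounded_linear (\<lambda>h. - blinfun_apply g (gradU \<iota> \<iota>\<^sub>0 (t - s) h $ j))" for g j
    by (intro bounded_linear_minus bounded_linear_compose[OF blinfun.bounded_linear_right]
        bounded_linear_compose[OF bounded_linear_vec_nth lin])
  have "blinfun_apply (gradU_dual \<iota> \<iota>\<^sub>0 (t - s) j g) h = - blinfun_apply g (gradU \<iota> \<iota>\<^sub>0 (t - s) h $ j)"
    for g j
    unfolding gradU_dual_def bounded_linear_Blinfun_apply[OF bl] ..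
  then show ?thesis
    by (simp add: B_integrand_def divU_dual_def blinfun.sum_left)
qed

theorem theorem3p4:
  fixes \<iota> :: "'e::banach \<Rightarrow> 'n::finite dist"
    and \<iota>\<^sub>0 :: "'f::banach \<Rightarrow> 'n dist"
    and \<sigma> \<sigma>\<^sub>0 :: real
    and R :: "'n \<Rightarrow> ('f \<Rightarrow>\<^sub>L real) \<Rightarrow> ('f \<Rightarrow>\<^sub>L real)"
    and m :: "('e \<Rightarrow>\<^sub>L real) \<Rightarrow> ('e \<Rightarrow>\<^sub>L real) \<Rightarrow> ('f \<Rightarrow>\<^sub>L real)"
  assumes dim: "CARD('n) \<ge> 3"
    and H1: "class_G \<iota> \<sigma>" "class_G \<iota>\<^sub>0 \<sigma>\<^sub>0"
    and H2: "riesz_bounded \<iota>\<^sub>0 R"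
    and H3: "product_bounded \<iota> \<iota>\<^sub>0 m"
    and H4: "gradU_integrable \<iota> \<iota>\<^sub>0 \<sigma> \<sigma>\<^sub>0"
    and critical: "\<sigma>\<^sub>0 - \<sigma> - 1 = 0"
  shows "\<exists>K>0. \<forall>T>0. \<forall>u\<in>Linf T. \<forall>v\<in>Linf T.
           (\<forall>t\<in>time_interval T. is_B \<iota> \<iota>\<^sub>0 R m u v t (B \<iota> \<iota>\<^sub>0 R m u v t)) \<and>
           (SUP t\<in>time_interval T. ereal (norm (B \<iota> \<iota>\<^sub>0 R m u v t)))
             \<le> ereal K * Linf_norm T u * Linf_norm T v"
proof -
  have R: "bounded_linear (R j)" for j
    using H2 unfolding riesz_bounded_def by blast
  \<comment> \<open>Product and projection are merged into one bounded bilinear map, whose constant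
    \<open>P\<close> depends only on \<open>R\<close> and \<open>m\<close>.\<close>
  define p where "p a b = leray R (tensor m a b)" for a b
  have bil: "bounded_bilinear p"
    unfolding p_def[abs_def]
    by (rule bounded_bilinear_linear_compose[OF
          bounded_bilinear_tensor[OF bounded_bilinear_if_product_bounded[OF H3]]
          bounded_linear_leray[OF R]])
  obtain P where P: "P > 0" "\<And>a b. norm (p a b) \<le> norm a * norm b * P"
    using bounded_bilinear.pos_bounded[OF bil] by blast
  have grad_lin: "bounded_linear (gradU \<iota> \<iota>\<^sub>0 t)" if "t > 0" for t
    using H4 that unfolding gradU_integrable_def by blast
  have grad_meas: "(\<lambda>s. blinfun_apply g (gradU \<iota> \<iota>\<^sub>0 s f $ j)) \<in> borel_measurable (lebesgue_on {0<..})"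
    for f j and g :: "'f \<Rightarrow>\<^sub>L real"
    using H4 unfolding gradU_integrable_def by blast
  have exponent: "(\<sigma>\<^sub>0 - \<sigma>) / 2 - 1 / 2 = 0" using critical by (simp add: field_simps)
  obtain C where C: "C > 0"
    and grad0: "\<And>f. (\<integral>\<^sup>+s\<in>{0<..}. ennreal (s powr 0 * norm (gradU \<iota> \<iota>\<^sub>0 s f)) \<partial>lebesgue) \<le> ennreal (C * norm f)"
    using H4 unfolding gradU_integrable_def exponent by blast
  have grad: "(\<integral>\<^sup>+s\<in>{0<..}. ennreal (norm (gradU \<iota> \<iota>\<^sub>0 s f)) \<partial>lebesgue) \<le> ennreal (C * norm f)" for f
  proof -
    have "(\<integral>\<^sup>+s\<in>{0<..}. ennreal (norm (gradU \<iota> \<iota>\<^sub>0 s f)) \<partial>lebesgue)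
        = (\<integral>\<^sup>+s\<in>{0<..}. ennreal (s powr 0 * norm (gradU \<iota> \<iota>\<^sub>0 s f)) \<partial>lebesgue)"
      \<comment> \<open>Since \<open>0 powr 0 = 0\<close>, the weight equals one only away from
        \<open>s = 0\<close>; the indicator removes that point.\<close>
      by (rule nn_integral_cong) (auto split: split_indicator)
    then show ?thesis using grad0[of f] by simp
  qed
  define n where "n = real CARD('n)"
  have n: "n > 0" by (simp add: n_def)
  \<comment> \<open>The almost everywhere bounds of \<open>u\<close> and \<open>v\<close> enter as
    real numbers \<open>c\<close> and \<open>d\<close>; the essential suprema are substituted for
    them at the end.\<close>
  have main: "is_B \<iota> \<iota>\<^sub>0 R m u v t (B \<iota> \<iota>\<^sub>0 R m u v t) \<and>
      norm (B \<iota> \<iota>\<^sub>0 R m u v t) \<le> n * n * P * C * c * d"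
    if t: "t \<in> time_interval T" and u: "u \<in> Linf T" and v: "v \<in> Linf T" and "c \<ge> 0" "d \<ge> 0"
      and uc: "AE s in lebesgue_on (time_interval T). norm (u s) \<le> c"
      and vd: "AE s in lebesgue_on (time_interval T). norm (v s) \<le> d"
    for T u v t c d
  proof -
    let ?S = "{0<..<t}" and ?w = "\<lambda>s h. gradU \<iota> \<iota>\<^sub>0 (t - s) h"
    define F where "F k s h = blinfun_apply (B_integrand \<iota> \<iota>\<^sub>0 R m u v t s $ k) h" for k s h
    \<comment> \<open>Almost everywhere, \<open>c * d * P\<close> bounds each entry of
      \<open>p (u s) (v s)\<close>; the factor \<open>n\<close> counts the terms of the
      divergence.\<close>
    define A where "A = n * (c * d * P)"
    have A: "A \<ge> 0" using n P that by (simp add: A_def)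
    note sub = time_interval_subset[OF t]
    have F_eq: "F k s h = (\<Sum>j\<in>UNIV. - blinfun_apply (p (u s) (v s) $ k $ j) (?w s h $ j))"
      if "s \<in> ?S" for k s h
      using that unfolding F_def p_def by (intro B_integrand_apply grad_lin) auto
    have "strongly_measurable_on ?S u" "strongly_measurable_on ?S v"
      using u v sub sets_time_interval[of T]
      by (simp_all add: strongly_measurable_on_subset[OF strongly_measurable_on_Linf])
    then have p_meas: "strongly_measurable_on ?S (\<lambda>s. p (u s) (v s))"
      by (rule bounded_bilinear.strongly_measurable_on[OF bil])
    have F_meas: "(\<lambda>s. F k s h) \<in> borel_measurable (lebesgue_on ?S)" for k h
    proof -
      \<comment> \<open>The reflection maps \<open>{0<..<t}\<close> into the positive half-line,
        where the weak measurability of the gradient is given.\<close>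
      have refl: "(\<lambda>s. t - s) \<in> lebesgue_on ?S \<rightarrow>\<^sub>M lebesgue_on {0<..}"
        using lebesgue_affine_measurable[of "\<lambda>_. - 1 :: real" t]
        by (intro measurable_restrict_space3) auto
      have "(\<lambda>s. blinfun_apply (p (u s) (v s) $ k $ j) (?w s h $ j)) \<in> borel_measurable (lebesgue_on ?S)" for j
      proof (rule borel_measurable_strongly_measurable_apply[OF _ p_meas])
        show "(\<lambda>s. blinfun_apply (y $ k $ j) (?w s h $ j))
            \<in> borel_measurable (lebesgue_on ?S)" for y :: "('f \<Rightarrow>\<^sub>L real) ^ 'n ^ 'n"
          by (rule measurable_compose[OF refl grad_meas])
        show "continuous_on UNIV (\<lambda>y. blinfun_apply (y $ k $ j) (?w s h $ j) :: real)" for s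
          by (intro linear_continuous_on bounded_linear_compose[OF blinfun.bounded_linear_left]
              bounded_linear_compose[OF bounded_linear_vec_nth bounded_linear_vec_nth])
      qed simp
      then have "(\<lambda>s. \<Sum>j\<in>UNIV. - blinfun_apply (p (u s) (v s) $ k $ j) (?w s h $ j))
          \<in> borel_measurable (lebesgue_on ?S)"
        by (intro borel_measurable_sum borel_measurable_uminus)
      then show ?thesis
        by (subst measurable_cong[OF F_eq]) auto
    qed
    \<comment> \<open>The constant \<open>A\<close> is placed inside the gradient by linearity. The
      integral bound then applies to the vector \<open>A *\<^sub>R h\<close> itself, and no factor
      has to be taken out of an integral whose integrand may fail to be measurable.\<close>
    have F_le: "AE s in lebesgue_on ?S. \<bar>F k s h\<bar> \<le> norm (gradU \<iota> \<iota>\<^sub>0 (t - s) (A *\<^sub>R h))" for k h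
    proof -
      have "AE s in lebesgue. s \<in> time_interval T \<longrightarrow> norm (u s) \<le> c"
        "AE s in lebesgue. s \<in> time_interval T \<longrightarrow> norm (v s) \<le> d"
        using uc vd sets_time_interval[of T] by (simp_all add: AE_restrict_space_iff)
      then have "AE s in lebesgue. s \<in> ?S \<longrightarrow> \<bar>F k s h\<bar> \<le> norm (?w s (A *\<^sub>R h))"
      proof (eventually_elim, intro impI)
        fix s assume us: "s \<in> time_interval T \<longrightarrow> norm (u s) \<le> c"
          and vs: "s \<in> time_interval T \<longrightarrow> norm (v s) \<le> d" and s: "s \<in> ?S"
        have p_le: "norm (p (u s) (v s)) \<le> c * d * P"
        proof -
          have "norm (p (u s) (v s)) \<le> norm (u s) * norm (v s) * P"
            by (rule P)
          also have "\<dots> \<le> c * d * P"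
            using us vs s sub P(1) \<open>c \<ge> 0\<close> by (intro mult_right_mono mult_mono) auto
          finally show ?thesis .
        qed
        have "\<bar>F k s h\<bar> \<le> (\<Sum>j\<in>(UNIV::'n set). c * d * P * norm (?w s h))"
          unfolding F_eq[OF s]
        proof (rule order_trans[OF sum_abs sum_mono])
          fix j
          have "\<bar>- blinfun_apply (p (u s) (v s) $ k $ j) (?w s h $ j)\<bar>
              \<le> norm (p (u s) (v s) $ k $ j) * norm (?w s h $ j)"
            using norm_blinfun[of "p (u s) (v s) $ k $ j" "?w s h $ j"] by simp
          also have "\<dots> \<le> norm (p (u s) (v s)) * norm (?w s h)"
            by (intro mult_mono Finite_Cartesian_Product.norm_nth_le
                order_trans[OF Finite_Cartesian_Product.norm_nth_le Finite_Cartesian_Product.norm_nth_le]) auto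
          also have "\<dots> \<le> c * d * P * norm (?w s h)"
            by (intro mult_right_mono p_le) simp
          finally show "\<bar>- blinfun_apply (p (u s) (v s) $ k $ j) (?w s h $ j)\<bar> \<le> c * d * P * norm (?w s h)" .
        qed
        also have "\<dots> = norm (?w s (A *\<^sub>R h))"
          using A s linear_scale[OF bounded_linear.linear[OF grad_lin], of "t - s" A h]
          by (simp add: A_def n_def)
        finally show "\<bar>F k s h\<bar> \<le> norm (?w s (A *\<^sub>R h))" .
      qed
      then show ?thesis by (simp add: AE_restrict_space_iff)
    qed
    have F_bound: "(\<integral>\<^sup>+s. ennreal \<bar>F k s h\<bar> \<partial>lebesgue_on ?S) \<le> ennreal (A * C * norm h)" for k h
    proof -
      have "(\<integral>\<^sup>+s. ennreal \<bar>F k s h\<bar> \<partial>lebesgue_on ?S)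
          \<le> (\<integral>\<^sup>+s\<in>{0<..}. ennreal (norm (gradU \<iota> \<iota>\<^sub>0 s (A *\<^sub>R h))) \<partial>lebesgue)"
        by (rule nn_integral_reflect_le[OF F_meas F_le])
      also have "\<dots> \<le> ennreal (C * norm (A *\<^sub>R h))"
        by (rule grad)
      finally show ?thesis using A by (simp add: mult_ac)
    qed
    have "\<exists>b. norm b \<le> A * C \<and> (\<forall>h. set_integrable lebesgue ?S (\<lambda>s. F k s h)) \<and>
        (\<forall>h. blinfun_apply b h = - (LINT s:?S|lebesgue. F k s h))" for k
    proof (rule weak_integral_exists[of ?S "F k" "A * C"])
      show "linear (F k s)" for s
        unfolding F_def by (rule bounded_linear.linear[OF blinfun.bounded_linear_right])
    qed (use A C F_meas F_bound in auto)
    then obtain b where b: "\<And>k. norm (b k) \<le> A * C"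
      "\<And>k h. set_integrable lebesgue ?S (\<lambda>s. F k s h)"
      "\<And>k h. blinfun_apply (b k) h = - (LINT s:?S|lebesgue. F k s h)"
      by metis
    have is_b: "is_B \<iota> \<iota>\<^sub>0 R m u v t (\<chi> k. b k)"
      unfolding is_B_def using b(2,3) by (simp add: F_def)
    \<comment> \<open>The second factor \<open>n\<close> arises here, from summing the norms of the
      components.\<close>
    have "norm (\<chi> k. b k) \<le> (\<Sum>k\<in>UNIV. norm (b k))"
      using norm_vec_le_sum[of "\<chi> k. b k"] by simp
    also have "\<dots> \<le> (\<Sum>k\<in>(UNIV::'n set). A * C)"
      by (intro sum_mono b)
    also have "\<dots> = n * n * P * C * c * d"
      by (simp add: A_def n_def mult_ac)
    finally show ?thesis using is_b B_eqI[OF is_b] by simp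
  qed
  show ?thesis
  \<comment> \<open>The constant combines the dimension, the bound \<open>P\<close> of the projected
    product and the bound \<open>C\<close> of the time integral; it is fixed before
    \<open>T\<close>, \<open>u\<close> and \<open>v\<close>.\<close>
  proof (intro exI[of _ "n * n * P * C"] conjI allI impI ballI)
    show "0 < n * n * P * C" using n P C by simp
  next
    fix T :: ereal and u v :: "real \<Rightarrow> ('e \<Rightarrow>\<^sub>L real) ^ 'n"
    assume T: "0 < T" and u: "u \<in> Linf T" and v: "v \<in> Linf T"
    obtain c where c: "c \<ge> 0" "Linf_norm T u = ereal c"
      "AE t in lebesgue_on (time_interval T). norm (u t) \<le> c"
      using Linf_norm_real[OF T u] .
    obtain d where d: "d \<ge> 0" "Linf_norm T v = ereal d"
      "AE t in lebesgue_on (time_interval T). norm (v t) \<le> d"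
      using Linf_norm_real[OF T v] .
    note main = main[OF _ u v c(1) d(1) c(3) d(3)]
    show "is_B \<iota> \<iota>\<^sub>0 R m u v t (B \<iota> \<iota>\<^sub>0 R m u v t)" if "t \<in> time_interval T" for t
      using main[OF that] by blast
    show "(SUP t\<in>time_interval T. ereal (norm (B \<iota> \<iota>\<^sub>0 R m u v t)))
        \<le> ereal (n * n * P * C) * Linf_norm T u * Linf_norm T v"
      unfolding c d by (rule SUP_least) (use main in simp)
  qed
qed

end
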